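(* Let $A,B,C,D\in\mathbb{C}^{n\times n}$ be such that $A$, $D$, $BC$ and $CB$ are *-DMP, and let $M=\begin{pmatrix}A&B\\ C&D\end{pmatrix}\in\mathbb{C}^{2n\times 2n}$. If $BC=0$, $CB=0$, $CA=DC$, $AC^*=C^*D$ and $$\sum_{i=1}^{i(D)}A^{m-i}BD^{i-1}D^{\pi}=0,\qquad \sum_{i=1}^{i(A)}A^{i-1}A^{\pi}BD^{m-i}=0$$ for some $m\geq\max\{i(A),i(D)\}$, then $M$ is *-DMP.
   Context: $\mathbb{C}^{k\times k}$ is the Banach *-algebra of $k\times k$ complex matrices with conjugate transpose $X^*$ as involution. The Drazin inverse $X^D$ of a matrix $X$ is the unique matrix $Y$ with $YX^{k+1}=X^k$ for some $k$, $XY^2=Y$, $XY=YX$; the smallest such $k$ is the index $i(X)$, and $X^{\pi}=I-XX^D$ (the superscript $D$ denotes the Drazin inverse, not the block $D$). Also $X^0=I$. A matrix $X$ is *-DMP if there is a positive integer $r$ such that $X^r$ has a Moore-Penrose inverse and a group inverse and $(X^r)^{\dag}=(X^r)^{\#}$ (here $Z^{\dag}$ is the $Y$ with $ZYZ=Z$, $YZY=Y$, $(ZY)^*=ZY$, $(YZ)^*=YZ$, and $Z^{\#}$ is the $Y$ with $ZYZ=Z$, $YZY=Y$, $ZY=YZ$). *)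

theory Defs
  imports "Jordan_Normal_Form.Schur_Decomposition"
begin

text \<open>
  The dimension of a candidate inverse is read off from the matrix itself; all notions below are
  meant for square matrices.
\<close>

definition is_mp_inverse :: "complex mat \<Rightarrow> complex mat \<Rightarrow> bool" where
  "is_mp_inverse Z Y \<longleftrightarrow> Y \<in> carrier_mat (dim_col Z) (dim_row Z) \<and>
     Z * Y * Z = Z \<and> Y * Z * Y = Y \<and>
     mat_adjoint (Z * Y) = Z * Y \<and> mat_adjoint (Y * Z) = Y * Z"

definition is_group_inverse :: "complex mat \<Rightarrow> complex mat \<Rightarrow> bool" where
  "is_group_inverse Z Y \<longleftrightarrow> Y \<in> carrier_mat (dim_row Z) (dim_row Z) \<and>
     Z * Y * Z = Z \<and> Y * Z * Y = Y \<and> Z * Y = Y * Z"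

definition mp_inverse :: "complex mat \<Rightarrow> complex mat" where
  "mp_inverse Z = (THE Y. is_mp_inverse Z Y)"

definition group_inverse :: "complex mat \<Rightarrow> complex mat" where
  "group_inverse Z = (THE Y. is_group_inverse Z Y)"

definition star_DMP :: "complex mat \<Rightarrow> bool" where
  "star_DMP X \<longleftrightarrow> (\<exists>r>0. (\<exists>Y. is_mp_inverse (X ^\<^sub>m r) Y) \<and> (\<exists>Y. is_group_inverse (X ^\<^sub>m r) Y) \<and>
     mp_inverse (X ^\<^sub>m r) = group_inverse (X ^\<^sub>m r))"

definition is_drazin_inverse_at :: "nat \<Rightarrow> complex mat \<Rightarrow> complex mat \<Rightarrow> bool" where
  "is_drazin_inverse_at k X Y \<longleftrightarrow> Y \<in> carrier_mat (dim_row X) (dim_row X) \<and>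
     Y * X ^\<^sub>m (k + 1) = X ^\<^sub>m k \<and> X * Y ^\<^sub>m 2 = Y \<and> X * Y = Y * X"

definition drazin_inverse :: "complex mat \<Rightarrow> complex mat" where
  "drazin_inverse X = (THE Y. \<exists>k. is_drazin_inverse_at k X Y)"

definition drazin_index :: "complex mat \<Rightarrow> nat" where
  "drazin_index X = (LEAST k. is_drazin_inverse_at k X (drazin_inverse X))"

definition spectral_idempotent :: "complex mat \<Rightarrow> complex mat" where
  "spectral_idempotent X = 1\<^sub>m (dim_row X) - X * drazin_inverse X"

text \<open>
  The type of matrices is not an additive monoid (its zero depends on the dimensions), so finite
  sums are taken in the ring of \<open>n \<times> n\<close> matrices.
\<close>

abbreviation mat_sum :: "nat \<Rightarrow> (nat \<Rightarrow> complex mat) \<Rightarrow> nat set \<Rightarrow> complex mat" where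
  "mat_sum n f I \<equiv> finsum (ring_mat TYPE(complex) n ()) f I"

end

theory Submission
  imports Defs
begin

text \<open>
  A matrix \<open>X\<close> is *-DMP iff its core idempotent \<open>X X\<^sup>D\<close> is Hermitian (lemma \<open>star_DMP_iff_drazin\<close>).
  This is so because a positive power \<open>X\<^sup>r\<close> with a group inverse satisfies
  \<open>X\<^sup>r (X\<^sup>r)\<^sup># = X X\<^sup>D\<close>, and a group inverse is the Moore-Penrose inverse exactly when the associated
  idempotent is Hermitian.

  Write \<open>M = P + Q\<close>, where \<open>P\<close> is the block upper triangular matrix with blocks \<open>A\<close>, \<open>B\<close>, \<open>0\<close>, \<open>D\<close> and
  \<open>Q\<close> has the single nonzero block \<open>C\<close>. From \<open>B C = C B = 0\<close> and \<open>C A = D C\<close> it follows that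
  \<open>P Q = Q P\<close>, and \<open>Q\<^sup>2 = 0\<close>. A commuting square-zero summand does not change the core idempotent: the
  Drazin inverse of \<open>M\<close> is \<open>Y - Y\<^sup>2 Q\<close> with \<open>Y = P\<^sup>D\<close>, and \<open>M (Y - Y\<^sup>2 Q) = P Y\<close> (lemma
  \<open>is_drazin_inverse_at_add_nilpotent\<close>). So it is enough to treat \<open>P\<close>.

  The power \<open>P\<^sup>m\<close> is block upper triangular with diagonal blocks \<open>A\<^sup>m\<close>, \<open>D\<^sup>m\<close> and off-diagonal block
  \<open>S = (\<Sum>i=1..m. A\<^sup>m\<^sup>-\<^sup>i B D\<^sup>i\<^sup>-\<^sup>1)\<close>. The two vanishing sums say \<open>S D\<^sup>\<pi> = 0\<close> and \<open>A\<^sup>\<pi> S = 0\<close>, that is,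
  \<open>S = A A\<^sup>D S = S D D\<^sup>D\<close>. Under these conditions \<open>P\<^sup>m\<close> has a group inverse for which the core
  idempotent is the block diagonal matrix with blocks \<open>A A\<^sup>D\<close> and \<open>D D\<^sup>D\<close> (lemma
  \<open>is_group_inverse_upper_block\<close>), and this is Hermitian because \<open>A\<close> and \<open>D\<close> are *-DMP.
\<close>

section \<open>Conjugate transposes and commuting matrices\<close>

lemma mat_adjoint_index:
  assumes "i < dim_col X" and "j < dim_row X"
  shows "mat_adjoint X $$ (i, j) = conjugate (X $$ (j, i))"
  using assms by (simp add: mat_adjoint_def mat_of_rows_index)

lemma mat_adjoint_dim [simp]:
  "dim_row (mat_adjoint X) = dim_col X" "dim_col (mat_adjoint X) = dim_row X"
  by (simp_all add: mat_adjoint_def)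

lemma mat_adjoint_mult:
  fixes X Y :: "complex mat"
  assumes "X \<in> carrier_mat n l" and "Y \<in> carrier_mat l k"
  shows "mat_adjoint (X * Y) = mat_adjoint Y * mat_adjoint X"
  using assms
  by (intro eq_matI) (auto simp: mat_adjoint_index scalar_prod_def cnj_sum mult.commute)

lemma mat_adjoint_diag_block:
  fixes X Y :: "complex mat"
  assumes "X \<in> carrier_mat n n" and "Y \<in> carrier_mat l l"
  shows "mat_adjoint (four_block_mat X (0\<^sub>m n l) (0\<^sub>m l n) Y) =
    four_block_mat (mat_adjoint X) (0\<^sub>m n l) (0\<^sub>m l n) (mat_adjoint Y)"
  using assms by (intro eq_matI) (auto simp: mat_adjoint_index)

lemma mat_left_commute:
  assumes "X \<in> carrier_mat n n" "T \<in> carrier_mat n n" "S \<in> carrier_mat n n" and "X * T = T * X"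
  shows "X * (T * S) = T * (X * S)"
  using assms assoc_mult_mat[of X n n T n S n] assoc_mult_mat[of T n n X n S n] by simp

lemma pow_mat_commute:
  assumes X: "X \<in> carrier_mat n n" and T: "T \<in> carrier_mat n n" and c: "X * T = T * X"
  shows "X ^\<^sub>m k * T = T * X ^\<^sub>m k"
proof (induction k)
  case 0
  then show ?case using X T by simp
next
  case (Suc k)
  have Xk: "X ^\<^sub>m k \<in> carrier_mat n n" using X by simp
  have "X ^\<^sub>m Suc k * T = X ^\<^sub>m k * T * X"
    using X T Xk c by (simp add: assoc_mult_mat[of _ n n _ n _ n])
  also have "\<dots> = T * X ^\<^sub>m Suc k"
    using X T Xk by (simp only: Suc.IH) (simp add: assoc_mult_mat[of _ n n _ n _ n])
  finally show ?case .
qed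

lemma pow_mat_Suc_left:
  assumes "X \<in> carrier_mat n n"
  shows "X ^\<^sub>m Suc k = X * X ^\<^sub>m k"
  using pow_mat_commute[OF assms assms refl] by simp

lemma pow_mat_add:
  assumes X: "X \<in> carrier_mat n n"
  shows "X ^\<^sub>m (k + l) = X ^\<^sub>m k * X ^\<^sub>m l"
proof (induction l)
  case 0
  then show ?case using X by simp
next
  case (Suc l)
  then show ?case using X by (simp add: assoc_mult_mat[of _ n n _ n _ n])
qed

section \<open>Group inverses and Moore-Penrose inverses\<close>

text \<open>
  The group inverse \<open>G\<close> lies in the double commutant of \<open>Z\<close>. The point is that \<open>Z G\<close> commutes with
  \<open>T\<close>: as \<open>Z = G Z\<^sup>2 = Z\<^sup>2 G\<close>, both \<open>Z G T\<close> and \<open>T Z G\<close> equal \<open>G Z\<^sup>2 T G\<close>.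
\<close>

lemma is_group_inverse_commute:
  assumes Z: "Z \<in> carrier_mat n n" and T: "T \<in> carrier_mat n n"
    and G: "is_group_inverse Z G" and c: "Z * T = T * Z"
  shows "G * T = T * G"
proof -
  have Gc: "G \<in> carrier_mat n n" and ZGZ: "Z * G * Z = Z" and GZG: "G * Z * G = G"
    and ZG: "Z * G = G * Z"
    using G Z by (auto simp: is_group_inverse_def)
  note a = assoc_mult_mat[of _ n n _ n _ n]
  note cs = Z T Gc
  have GZZ: "G * (Z * Z) = Z" using ZGZ[unfolded ZG] cs by (simp add: a)
  have ZZG: "Z * (Z * G) = Z" by (subst ZG) (use ZGZ cs in \<open>simp add: a\<close>)
  have ZTS: "Z * (T * S) = T * (Z * S)" if "S \<in> carrier_mat n n" for S
    using mat_left_commute[OF Z T that c] .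
  have "G * (Z * T) = G * (T * (Z * (Z * G)))" using ZZG c by simp
  also have "\<dots> = G * (Z * Z) * (T * G)" using cs by (simp add: a ZTS)
  also have "\<dots> = Z * (T * G)" using GZZ by simp
  also have "\<dots> = T * (Z * G)" using cs ZTS by simp
  finally have e: "G * (Z * T) = T * (Z * G)" .
  have GGZ: "G * (G * Z) = G" using GZG cs by (simp add: a ZG)
  have ZGG: "Z * (G * G) = G * (G * Z)" by (metis GZG ZG a Z Gc)
  have "G * T = G * (G * Z) * T" using GGZ by simp
  also have "\<dots> = G * (G * (Z * T))" using cs by (simp add: a)
  also have "\<dots> = G * (Z * (T * G))" using e cs ZTS by simp
  also have "\<dots> = G * (Z * T) * G" using cs by (simp add: a)
  also have "\<dots> = T * (Z * (G * G))" unfolding e using cs by (simp add: a)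
  also have "\<dots> = T * G" using ZGG GGZ by simp
  finally show ?thesis .
qed

lemma is_group_inverse_unique:
  assumes Z: "Z \<in> carrier_mat n n" and "is_group_inverse Z G" and "is_group_inverse Z H"
  shows "G = H"
proof -
  have c: "G \<in> carrier_mat n n" "H \<in> carrier_mat n n"
    and g: "Z * G * Z = Z" "G * Z * G = G" "Z * G = G * Z"
    and h: "Z * H * Z = Z" "H * Z * H = H" "Z * H = H * Z"
    using assms by (auto simp: is_group_inverse_def)
  note a = assoc_mult_mat[of _ n n _ n _ n]
  have "Z * G = Z * H * (Z * G)" using h Z c by (simp add: a[symmetric] del: assoc_mult_mat)
  also have "\<dots> = H * Z * (G * Z)" by (simp only: g(3) h(3))
  also have "\<dots> = H * (Z * G * Z)" using Z c by (simp add: a)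
  also have "\<dots> = Z * H" using g h by simp
  finally have e: "Z * G = Z * H" .
  have "G = G * (Z * H)" using g(2) e Z c by (simp add: a)
  also have "\<dots> = H * Z * H" using a e g(3) h(3) Z c by metis
  finally show ?thesis using h by simp
qed

lemma is_mp_inverse_unique:
  assumes Z: "Z \<in> carrier_mat n n" and "is_mp_inverse Z G" and "is_mp_inverse Z H"
  shows "G = H"
proof -
  have c: "G \<in> carrier_mat n n" "H \<in> carrier_mat n n"
    and g: "Z * G * Z = Z" "G * Z * G = G" "mat_adjoint (Z * G) = Z * G" "mat_adjoint (G * Z) = G * Z"
    and h: "Z * H * Z = Z" "H * Z * H = H" "mat_adjoint (Z * H) = Z * H" "mat_adjoint (H * Z) = H * Z"
    using assms by (auto simp: is_mp_inverse_def)
  note a = assoc_mult_mat[of _ n n _ n _ n]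
  have "Z * G = mat_adjoint ((Z * H) * (Z * G))" using h g Z c by (simp add: a[symmetric] del: assoc_mult_mat)
  also have "\<dots> = (Z * G) * (Z * H)"
    using mat_adjoint_mult[of "Z * H" n n "Z * G" n] g h Z c by simp
  also have "\<dots> = Z * H" using g Z c by (simp add: a[symmetric] del: assoc_mult_mat)
  finally have e: "Z * G = Z * H" .
  have "G * Z = mat_adjoint ((G * Z) * (H * Z))" using h g Z c by (simp add: a)
  also have "\<dots> = (H * Z) * (G * Z)"
    using mat_adjoint_mult[of "G * Z" n n "H * Z" n] g h Z c by simp
  also have "\<dots> = H * Z" using g Z c by (simp add: a)
  finally have f: "G * Z = H * Z" .
  have "G = G * (Z * H)" using g(2) e Z c by (simp add: a)
  also have "\<dots> = H * Z * H" using f Z c by (simp add: a[symmetric] del: assoc_mult_mat)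
  finally show ?thesis using h by simp
qed

text \<open>
  Equality of the two inverses means that a single matrix is both of them, and a group inverse \<open>G\<close>
  of \<open>Z\<close> is the Moore-Penrose inverse exactly when the idempotent \<open>Z G = G Z\<close> is Hermitian.
\<close>
lemma star_DMP_iff_group_inverse:
  assumes X: "X \<in> carrier_mat n n"
  shows "star_DMP X \<longleftrightarrow>
    (\<exists>r>0. \<exists>G. is_group_inverse (X ^\<^sub>m r) G \<and> mat_adjoint (X ^\<^sub>m r * G) = X ^\<^sub>m r * G)"
proof -
  have mp: "mp_inverse (X ^\<^sub>m r) = G" if "is_mp_inverse (X ^\<^sub>m r) G" for r G
    unfolding mp_inverse_def
    using that X is_mp_inverse_unique[of "X ^\<^sub>m r" n] by (intro the_equality) auto
  have gr: "group_inverse (X ^\<^sub>m r) = G" if "is_group_inverse (X ^\<^sub>m r) G" for r G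
    unfolding group_inverse_def
    using that X is_group_inverse_unique[of "X ^\<^sub>m r" n] by (intro the_equality) auto
  have "(\<exists>Y. is_mp_inverse (X ^\<^sub>m r) Y) \<and> (\<exists>Y. is_group_inverse (X ^\<^sub>m r) Y) \<and>
      mp_inverse (X ^\<^sub>m r) = group_inverse (X ^\<^sub>m r) \<longleftrightarrow>
    (\<exists>G. is_group_inverse (X ^\<^sub>m r) G \<and> mat_adjoint (X ^\<^sub>m r * G) = X ^\<^sub>m r * G)"
    (is "?L \<longleftrightarrow> ?R") if "r > 0" for r
  proof
    assume ?L
    then obtain G where "is_mp_inverse (X ^\<^sub>m r) G" "is_group_inverse (X ^\<^sub>m r) G"
      using mp gr by metis
    then show ?R by (auto simp: is_mp_inverse_def)
  next
    assume ?R
    then obtain G where G: "is_group_inverse (X ^\<^sub>m r) G"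
      and h: "mat_adjoint (X ^\<^sub>m r * G) = X ^\<^sub>m r * G" by blast
    have "is_mp_inverse (X ^\<^sub>m r) G"
      using G h X that by (auto simp: is_mp_inverse_def is_group_inverse_def)
    then show ?L using G mp gr by metis
  qed
  then show ?thesis unfolding star_DMP_def by blast
qed

section \<open>Drazin inverses\<close>

lemma is_drazin_inverse_at_iff:
  assumes "X \<in> carrier_mat n n"
  shows "is_drazin_inverse_at k X Y \<longleftrightarrow> Y \<in> carrier_mat n n \<and>
    Y * X ^\<^sub>m Suc k = X ^\<^sub>m k \<and> X * (Y * Y) = Y \<and> X * Y = Y * X"
proof (cases "Y \<in> carrier_mat n n")
  case True
  then have "Y ^\<^sub>m 2 = Y * Y" by (simp add: numeral_2_eq_2)
  then show ?thesis using assms True by (simp add: is_drazin_inverse_at_def)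
next
  case False
  then show ?thesis using assms by (simp add: is_drazin_inverse_at_def)
qed

text \<open>
  A Drazin inverse at \<open>k\<close> turns into a group inverse for every positive power with exponent at least
  \<open>k\<close>, with the same associated idempotent \<open>X Y\<close>.
\<close>
lemma is_drazin_inverse_at_power:
  assumes X: "X \<in> carrier_mat n n" and Y: "is_drazin_inverse_at k X Y" and r: "r > 0" "r \<ge> k"
  shows "X ^\<^sub>m r * Y ^\<^sub>m r = X * Y" and "X * Y * X ^\<^sub>m r = X ^\<^sub>m r"
    and "is_group_inverse (X ^\<^sub>m r) (Y ^\<^sub>m r)"
proof -
  note a = assoc_mult_mat[of _ n n _ n _ n]
  have Yc: "Y \<in> carrier_mat n n" and d: "Y * X ^\<^sub>m Suc k = X ^\<^sub>m k" "X * (Y * Y) = Y" "X * Y = Y * X"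
    using Y is_drazin_inverse_at_iff[OF X] by blast+
  have EY: "X * Y * Y = Y" using d(2) X Yc by (simp add: a)
  have EYs: "X * Y * Y ^\<^sub>m Suc s = Y ^\<^sub>m Suc s" for s
  proof -
    have "X * Y * Y ^\<^sub>m Suc s = (X * Y * Y) * Y ^\<^sub>m s"
      unfolding pow_mat_Suc_left[OF Yc] using X Yc by (simp add: a)
    then show ?thesis using EY pow_mat_Suc_left[OF Yc] by simp
  qed
  have p: "X ^\<^sub>m Suc s * Y ^\<^sub>m Suc s = X * Y" for s
  proof (induction s)
    case 0
    then show ?case using X Yc by simp
  next
    case (Suc s)
    have "X ^\<^sub>m Suc (Suc s) * Y ^\<^sub>m Suc (Suc s) = X ^\<^sub>m Suc s * (X * Y * Y ^\<^sub>m Suc s)"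
      unfolding pow_mat_Suc_left[OF Yc, of "Suc s"] pow_mat.simps(2)[of X "Suc s"]
      using X Yc by (simp add: a del: pow_mat.simps)
    then show ?case using EYs Suc by simp
  qed
  from r obtain s where s: "r = Suc s" by (cases r) auto
  show XYr: "X ^\<^sub>m r * Y ^\<^sub>m r = X * Y" using p s by simp
  have "X * Y * X ^\<^sub>m k = X ^\<^sub>m k"
    using d(1,3) X Yc pow_mat_Suc_left[OF X] by (simp add: a)
  moreover have "X ^\<^sub>m r = X ^\<^sub>m k * X ^\<^sub>m (r - k)" using pow_mat_add[OF X] r by (metis le_add_diff_inverse)
  ultimately show Er: "X * Y * X ^\<^sub>m r = X ^\<^sub>m r"
    using X Yc by (metis a mult_carrier_mat pow_carrier_mat)
  have "X ^\<^sub>m r * Y = Y * X ^\<^sub>m r" by (rule pow_mat_commute[OF X Yc d(3)])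
  then have c: "Y ^\<^sub>m r * X ^\<^sub>m r = X ^\<^sub>m r * Y ^\<^sub>m r"
    using pow_mat_commute[of Y n "X ^\<^sub>m r" r] X Yc by simp
  show "is_group_inverse (X ^\<^sub>m r) (Y ^\<^sub>m r)"
    unfolding is_group_inverse_def
    using X Yc XYr Er c EYs[of s] s by (auto simp del: pow_mat.simps assoc_mult_mat)
qed

lemma is_drazin_inverse_at_unique:
  assumes X: "X \<in> carrier_mat n n" and Y: "is_drazin_inverse_at k X Y"
    and Y': "is_drazin_inverse_at k' X Y'"
  shows "Y = Y'"
proof -
  note a = assoc_mult_mat[of _ n n _ n _ n]
  define r where "r = Suc (k + k')"
  have "Y ^\<^sub>m r = Y' ^\<^sub>m r"
    using is_drazin_inverse_at_power(3)[OF X Y, of r] is_drazin_inverse_at_power(3)[OF X Y', of r]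
    is_group_inverse_unique[OF pow_carrier_mat[OF X]] by (metis (no_types) r_def le_SucI le_add1 le_add2 zero_less_Suc)
  then have e: "X * Y = X * Y'"
    using is_drazin_inverse_at_power(1)[OF X Y, of r] is_drazin_inverse_at_power(1)[OF X Y', of r]
    by (simp add: r_def)
  have c: "Y \<in> carrier_mat n n" "X * (Y * Y) = Y" "X * Y = Y * X"
    "Y' \<in> carrier_mat n n" "X * (Y' * Y') = Y'" "X * Y' = Y' * X"
    using Y Y' is_drazin_inverse_at_iff[OF X] by blast+
  have "Y = Y * (X * Y')" using c e X by (metis a)
  also have "\<dots> = X * Y' * Y'" using c e X by (metis a)
  finally show ?thesis using c(4,5) X by (simp add: a)
qed

text \<open>
  Conversely, a group inverse of one positive power yields a Drazin inverse, again with the same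
  idempotent.
\<close>
lemma is_drazin_inverse_at_of_group_inverse:
  assumes X: "X \<in> carrier_mat n n" and r: "r > 0" and G: "is_group_inverse (X ^\<^sub>m r) G"
  shows "is_drazin_inverse_at r X (X ^\<^sub>m (r - 1) * G)" and "X * (X ^\<^sub>m (r - 1) * G) = X ^\<^sub>m r * G"
proof -
  note a = assoc_mult_mat[of _ n n _ n _ n]
  from r obtain s where s: "r = Suc s" by (cases r) auto
  define Z where "Z = X ^\<^sub>m s"
  have Zc: "Z \<in> carrier_mat n n" and XZ: "X * Z = Z * X" and Xr: "X ^\<^sub>m r = X * Z"
    using X s pow_mat_Suc_left[OF X, of s] by (auto simp: Z_def)
  have g: "G \<in> carrier_mat n n" "X * Z * G * (X * Z) = X * Z" "G * (X * Z) * G = G" "X * Z * G = G * (X * Z)"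
    using G X Zc unfolding is_group_inverse_def Xr by auto
  have ZX: "Z * X = X * Z" using XZ by simp
  have XrX: "X ^\<^sub>m r * X = X * X ^\<^sub>m r" by (rule pow_mat_commute[OF X X refl])
  have XrZ: "X ^\<^sub>m r * Z = Z * X ^\<^sub>m r"
    unfolding Xr using X Zc by (simp add: a ZX mat_left_commute[OF Zc X _ ZX])
  have GX: "G * X = X * G"
    by (rule is_group_inverse_commute[OF _ X G XrX]) (use X in simp)
  have GZ: "G * Z = Z * G"
    by (rule is_group_inverse_commute[OF _ Zc G XrZ]) (use X in simp)
  note comm = GX GZ ZX mat_left_commute[OF g(1) X _ GX] mat_left_commute[OF g(1) Zc _ GZ]
    mat_left_commute[OF Zc X _ ZX]
  have Z2: "X * (X * (Z * (Z * G))) = X * Z"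
    using g(2) X Zc g(1) by (simp add: a comm)
  have G2: "X * (Z * (G * G)) = G"
    using g(3) X Zc g(1) by (simp add: a comm)
  show "X * (X ^\<^sub>m (r - 1) * G) = X ^\<^sub>m r * G"
    using X Zc g(1) by (simp add: Xr a) (simp add: s Z_def[symmetric])
  have 1: "Z * G * (X * Z * X) = X * Z"
    using Z2 X Zc g(1) by (simp add: a comm)
  have "X * (Z * G * (Z * G)) = Z * (X * (Z * (G * G)))"
    using X Zc g(1) by (simp add: a comm)
  then have 2: "X * (Z * G * (Z * G)) = Z * G" using G2 by simp
  have 3: "X * (Z * G) = Z * G * X"
    using X Zc g(1) by (simp add: a comm)
  show "is_drazin_inverse_at r X (X ^\<^sub>m (r - 1) * G)"
    using 1 2 3 X Zc g(1) unfolding is_drazin_inverse_at_iff[OF X] pow_mat.simps(2)[of X r] Xr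
    by (simp add: s Z_def[symmetric])
qed

text \<open>
  This form of the definition no longer mentions an exponent \<open>r\<close>: the matrix is *-DMP iff its core
  idempotent \<open>X X\<^sup>D\<close> is Hermitian. The remaining arguments are about that idempotent only.
\<close>
lemma star_DMP_iff_drazin:
  assumes X: "X \<in> carrier_mat n n"
  shows "star_DMP X \<longleftrightarrow> (\<exists>k Y. is_drazin_inverse_at k X Y \<and> mat_adjoint (X * Y) = X * Y)"
proof
  assume "star_DMP X"
  then show "\<exists>k Y. is_drazin_inverse_at k X Y \<and> mat_adjoint (X * Y) = X * Y"
    using is_drazin_inverse_at_of_group_inverse[OF X] unfolding star_DMP_iff_group_inverse[OF X]
    by metis
next
  assume "\<exists>k Y. is_drazin_inverse_at k X Y \<and> mat_adjoint (X * Y) = X * Y"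
  then show "star_DMP X"
    using is_drazin_inverse_at_power(1,3)[OF X, of _ _ "Suc _"]
    unfolding star_DMP_iff_group_inverse[OF X] by (metis zero_less_Suc le_SucI order_refl)
qed

lemma star_DMP_drazin_inverse:
  assumes X: "X \<in> carrier_mat n n" and s: "star_DMP X"
  shows "is_drazin_inverse_at (drazin_index X) X (drazin_inverse X)"
    and "mat_adjoint (X * drazin_inverse X) = X * drazin_inverse X"
proof -
  obtain k Y where Y: "is_drazin_inverse_at k X Y" and h: "mat_adjoint (X * Y) = X * Y"
    using s star_DMP_iff_drazin[OF X] by blast
  have "drazin_inverse X = Y"
    unfolding drazin_inverse_def
    using Y is_drazin_inverse_at_unique[OF X] by (intro the_equality) auto
  then show "mat_adjoint (X * drazin_inverse X) = X * drazin_inverse X"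
    and "is_drazin_inverse_at (drazin_index X) X (drazin_inverse X)"
    using h Y unfolding drazin_index_def by (auto intro: LeastI)
qed

text \<open>
  Adding a commuting square-zero matrix changes the Drazin inverse to \<open>Y - Y\<^sup>2 Q\<close> but leaves the
  idempotent as it is. The index may grow by one.
\<close>
lemma is_drazin_inverse_at_add_nilpotent:
  assumes P: "P \<in> carrier_mat n n" and Q: "Q \<in> carrier_mat n n"
    and Y: "is_drazin_inverse_at k P Y"
    and c: "P * Q = Q * P" and QQ: "Q * Q = 0\<^sub>m n n"
  shows "is_drazin_inverse_at (Suc k) (P + Q) (Y - Y * Y * Q)"
    and "(P + Q) * (Y - Y * Y * Q) = P * Y"
proof -
  note a = assoc_mult_mat[of _ n n _ n _ n]
  have Yc: "Y \<in> carrier_mat n n" and d: "Y * P ^\<^sub>m Suc k = P ^\<^sub>m k" "P * (Y * Y) = Y" "P * Y = Y * P"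
    using Y is_drazin_inverse_at_iff[OF P] by blast+
  have QP: "Q * P = P * Q" using c by simp
  have YP: "Y * P = P * Y" using d(3) by simp
  define G where "G = Y ^\<^sub>m Suc k"
  have G: "is_group_inverse (P ^\<^sub>m Suc k) G"
    using is_drazin_inverse_at_power[OF P Y, of "Suc k"] by (simp add: G_def)
  have Gc: "G \<in> carrier_mat n n" unfolding G_def by (rule pow_carrier_mat[OF Yc])
  \<comment> \<open>\<open>Y\<close> is a product of two matrices that commute with \<open>Q\<close>, so it commutes with \<open>Q\<close> as well.\<close>
  have "Y = P ^\<^sub>m k * G"
    using is_drazin_inverse_at_of_group_inverse(1)[OF P _ G] is_drazin_inverse_at_unique[OF P Y]
    by simp
  moreover have "G * Q = Q * G"
    by (rule is_group_inverse_commute[OF _ Q G pow_mat_commute[OF P Q c]]) (rule pow_carrier_mat[OF P])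
  moreover have Pk: "P ^\<^sub>m k \<in> carrier_mat n n" using P by simp
  ultimately have YQ: "Y * Q = Q * Y"
    using pow_mat_commute[OF P Q c, of k] mat_left_commute[OF Pk Q Gc] Q Gc by (simp add: a)
  \<comment> \<open>Oriented so that every product of \<open>P\<close>, \<open>Q\<close>, \<open>Y\<close> is rewritten with its factors in that order.\<close>
  note comm = QP YP YQ mat_left_commute[OF Q P _ QP] mat_left_commute[OF Yc P _ YP]
    mat_left_commute[OF Yc Q _ YQ]
  define U where "U = Y * Y * Q"
  have Uc: "U \<in> carrier_mat n n" using Yc Q by (simp add: U_def)
  have PU: "P * U = Q * Y"
  proof -
    have "P * U = P * (Y * Y) * Q" using P Yc Q by (simp add: U_def a)
    then show ?thesis using d(2) YQ by simp
  qed
  have UP: "U * P = Q * Y"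
    unfolding PU[symmetric] U_def using P Q Yc by (simp add: a comm)
  have "U = Q * (Y * Y)" unfolding U_def using Q Yc by (simp add: a comm)
  then have "Q * U = Q * Q * (Y * Y)" using Q Yc by (simp add: a)
  then have QU: "Q * U = 0\<^sub>m n n" unfolding QQ using Yc by simp
  have "U * Q = Y * Y * (Q * Q)" using Q Yc by (simp add: U_def a)
  then have UQ: "U * Q = 0\<^sub>m n n" unfolding QQ using Yc by simp
  have "P * Y * U = P * (Y * Y) * (Y * Q)" using P Q Yc by (simp add: U_def a)
  then have PYU: "P * Y * U = U" using d(2) Q Yc by (simp add: U_def a)
  have Yc': "Y - U \<in> carrier_mat n n" using Uc by (rule minus_carrier_mat)
  have PQ: "P + Q \<in> carrier_mat n n" using P Q by simp
  have PY: "P * Y \<in> carrier_mat n n" and QY: "Q * Y \<in> carrier_mat n n" using P Q Yc by simp_all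
  have cancel: "V - R + (R - 0\<^sub>m n n) = V"
    if "V \<in> carrier_mat n n" "R \<in> carrier_mat n n" for V R :: "complex mat"
    by (rule eq_matI) (use that in auto)
  have MY: "(P + Q) * (Y - U) = P * Y"
  proof -
    have "(P + Q) * (Y - U) = (P * Y - P * U) + (Q * Y - Q * U)"
      using add_mult_distrib_mat[OF P Q Yc'] mult_minus_distrib_mat[OF P Yc Uc]
        mult_minus_distrib_mat[OF Q Yc Uc] by simp
    also have "\<dots> = P * Y"
      unfolding PU QU by (rule cancel[OF PY QY])
    finally show ?thesis .
  qed
  have YM: "(Y - U) * (P + Q) = P * Y"
  proof -
    have "(Y - U) * (P + Q) = (Y * P - U * P) + (Y * Q - U * Q)"
      using mult_add_distrib_mat[OF Yc' P Q] minus_mult_distrib_mat[OF Yc Uc P]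
        minus_mult_distrib_mat[OF Yc Uc Q] by simp
    also have "\<dots> = P * Y"
      unfolding UP UQ YP YQ by (rule cancel[OF PY QY])
    finally show ?thesis .
  qed
  have "(P + Q) * ((Y - U) * (Y - U)) = P * Y * (Y - U)"
    unfolding MY[symmetric] using PQ Yc' by (simp add: a)
  also have "\<dots> = P * Y * Y - P * Y * U" by (rule mult_minus_distrib_mat[OF PY Yc Uc])
  also have "\<dots> = Y - U" unfolding PYU using d(2) P Yc by (simp add: a)
  finally have MYY: "(P + Q) * ((Y - U) * (Y - U)) = Y - U" .
  \<comment> \<open>By the binomial formula \<open>W = (j + 1) Q\<close>, as all terms with \<open>Q\<^sup>2\<close> vanish; only the shape below is needed.\<close>
  have pow: "\<exists>W. W \<in> carrier_mat n n \<and> W * P = P * W \<and> W * Q = 0\<^sub>m n n \<and> (P + Q) ^\<^sub>m Suc j = P ^\<^sub>m j * (P + W)" for j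
  proof (induction j)
    case 0
    then show ?case using P Q QP QQ by (intro exI[of _ Q]) simp
  next
    case (Suc j)
    then obtain W where W: "W \<in> carrier_mat n n" "W * P = P * W" "W * Q = 0\<^sub>m n n"
      "(P + Q) ^\<^sub>m Suc j = P ^\<^sub>m j * (P + W)" by blast
    have "(P + W) * (P + Q) = P * (P + (Q + W))"
    proof -
      have "(P + W) * (P + Q) = P * P + P * Q + (P * W + 0\<^sub>m n n)"
        using add_mult_distrib_mat[OF P W(1) PQ] mult_add_distrib_mat[OF P P Q]
          mult_add_distrib_mat[OF W(1) P Q] W(2,3) by simp
      also have "\<dots> = P * P + (P * Q + P * W)"
        using P Q W(1) by (simp add: assoc_add_mat[of _ n n])
      also have "\<dots> = P * (P + (Q + W))"
        using mult_add_distrib_mat[OF P P, of "Q + W"] mult_add_distrib_mat[OF P Q W(1)] Q W(1)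
        by simp
      finally show ?thesis .
    qed
    then have "(P + Q) ^\<^sub>m Suc (Suc j) = P ^\<^sub>m Suc j * (P + (Q + W))"
      unfolding pow_mat.simps(2)[of "P + Q" "Suc j"] W(4)
      using P PQ Q W(1) by (simp add: a)
    moreover have "(Q + W) * P = P * (Q + W)" "(Q + W) * Q = 0\<^sub>m n n"
      using add_mult_distrib_mat[OF Q W(1) P] mult_add_distrib_mat[OF P Q W(1)]
        add_mult_distrib_mat[OF Q W(1) Q] W(2,3) QP QQ by simp_all
    ultimately show ?case using Q W(1) by (intro exI[of _ "Q + W"]) auto
  qed
  obtain W where W: "W \<in> carrier_mat n n" "(P + Q) ^\<^sub>m Suc k = P ^\<^sub>m k * (P + W)"
    using pow by blast
  have MW: "(P + Q) ^\<^sub>m Suc k \<in> carrier_mat n n" using pow_carrier_mat[OF PQ] .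
  have "(Y - U) * (P + Q) ^\<^sub>m Suc (Suc k) = P * Y * (P + Q) ^\<^sub>m Suc k"
    unfolding pow_mat_Suc_left[OF PQ, of "Suc k"] YM[symmetric] using assoc_mult_mat[OF Yc' PQ MW] by simp
  also have "\<dots> = Y * P ^\<^sub>m Suc k * (P + W)"
    unfolding W(2) YP[symmetric] pow_mat_Suc_left[OF P] using P Yc W(1)
    by (simp add: a mult_carrier_mat[of _ n n _ n])
  finally have "(Y - U) * (P + Q) ^\<^sub>m Suc (Suc k) = (P + Q) ^\<^sub>m Suc k"
    using W d(1) by simp
  then show "is_drazin_inverse_at (Suc k) (P + Q) (Y - Y * Y * Q)"
    unfolding is_drazin_inverse_at_iff[OF PQ] U_def[symmetric] using MY YM MYY Yc' by simp
  show "(P + Q) * (Y - Y * Y * Q) = P * Y" using MY by (simp add: U_def)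
qed

lemma pow_mult_spectral_idempotent:
  assumes X: "X \<in> carrier_mat n n" and Y: "is_drazin_inverse_at k X (drazin_inverse X)" and "j \<ge> k"
  shows "X ^\<^sub>m j * spectral_idempotent X = 0\<^sub>m n n"
    and "spectral_idempotent X \<in> carrier_mat n n"
    and "X * spectral_idempotent X = spectral_idempotent X * X"
proof -
  note a = assoc_mult_mat[of _ n n _ n _ n]
  let ?Y = "drazin_inverse X"
  have Yc: "?Y \<in> carrier_mat n n" and d: "?Y * X ^\<^sub>m Suc k = X ^\<^sub>m k" "X * ?Y = ?Y * X"
    using Y is_drazin_inverse_at_iff[OF X] by blast+
  have c: "X ^\<^sub>m k * (X * ?Y) = X ^\<^sub>m k"
    using d pow_mat_commute[OF X Yc d(2), of "Suc k"] X Yc by (simp add: a)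
  have XXY: "X * (X * ?Y) = X * ?Y * X"
    using assoc_mult_mat[OF X Yc X] by (simp only: d(2)[symmetric])
  have s: "spectral_idempotent X = 1\<^sub>m n - X * ?Y" using X by (simp add: spectral_idempotent_def)
  then show sc: "spectral_idempotent X \<in> carrier_mat n n" using X Yc by (auto intro!: minus_carrier_mat)
  show "X * spectral_idempotent X = spectral_idempotent X * X"
    unfolding s using XXY X Yc
    by (simp add: mult_minus_distrib_mat[of _ n n _ n] minus_mult_distrib_mat[of _ n n _ _ n]
      del: assoc_mult_mat)
  have 0: "X ^\<^sub>m k * spectral_idempotent X = 0\<^sub>m n n"
    unfolding s using X Yc c by (simp add: mult_minus_distrib_mat[of _ n n _ n])
  have "X ^\<^sub>m j = X ^\<^sub>m (j - k) * X ^\<^sub>m k"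
    using pow_mat_add[OF X, of "j - k" k] \<open>j \<ge> k\<close> by simp
  then show "X ^\<^sub>m j * spectral_idempotent X = 0\<^sub>m n n"
    using 0 X sc by (simp add: a)
qed

section \<open>Block upper triangular matrices\<close>

text \<open>
  The two conditions on \<open>S\<close> say that its range lies in that of \<open>X\<close> and that it factors through the
  core idempotent of \<open>Z\<close>. Then the off-diagonal blocks of \<open>T K\<close> and \<open>K T\<close> cancel, and the idempotent of
  the block matrix is block diagonal.
\<close>

lemma is_group_inverse_upper_block:
  assumes X: "X \<in> carrier_mat n n" and S: "S \<in> carrier_mat n l" and Z: "Z \<in> carrier_mat l l"
    and G: "is_group_inverse X G" and H: "is_group_inverse Z H"
    and XS: "X * G * S = S" and SZ: "S * (Z * H) = S"
  defines "T \<equiv> four_block_mat X S (0\<^sub>m l n) Z"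
    and "K \<equiv> four_block_mat G (- (G * S * H)) (0\<^sub>m l n) H"
  shows "is_group_inverse T K"
    and "T * K = four_block_mat (X * G) (0\<^sub>m n l) (0\<^sub>m l n) (Z * H)"
proof -
  have Gc: "G \<in> carrier_mat n n" and g: "X * G * X = X" "G * X * G = G" "X * G = G * X"
    using G X by (auto simp: is_group_inverse_def)
  have Hc: "H \<in> carrier_mat l l" and h: "Z * H * Z = Z" "H * Z * H = H" "Z * H = H * Z"
    using H Z by (auto simp: is_group_inverse_def)
  define R where "R = G * S * H"
  have Rc: "R \<in> carrier_mat n l" using Gc S Hc by (simp add: R_def)
  note cs = X S Z Gc Hc Rc
  note as = assoc_mult_mat[of _ n n _ n _ n] assoc_mult_mat[of _ n n _ n _ l]
    assoc_mult_mat[of _ n n _ l _ l] assoc_mult_mat[of _ n l _ l _ l]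
    and mc = mult_carrier_mat[of _ n n _ l] mult_carrier_mat[of _ n l _ l]
  have XR: "X * R = S * H"
  proof -
    have "X * R = X * G * S * H" using cs by (simp add: R_def as mc)
    then show ?thesis using XS by simp
  qed
  have RZ: "R * Z = G * S"
  proof -
    have "R * Z = G * (S * (H * Z))" using cs by (simp add: R_def as mc)
    then show ?thesis using SZ h(3) by simp
  qed
  have GXR: "G * X * R = R"
  proof -
    have "G * X * R = G * X * G * (S * H)" using cs by (simp add: R_def as mc)
    then show ?thesis using g(2) cs by (simp add: R_def as)
  qed
  show TK: "T * K = four_block_mat (X * G) (0\<^sub>m n l) (0\<^sub>m l n) (Z * H)"
    unfolding T_def K_def R_def[symmetric]
    by (subst mult_four_block_mat[of _ n n _ l _ l _ _ n _ l]) (use cs XR in auto)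
  have KT: "K * T = four_block_mat (X * G) (0\<^sub>m n l) (0\<^sub>m l n) (Z * H)"
    unfolding T_def K_def R_def[symmetric]
    by (subst mult_four_block_mat[of _ n n _ l _ l _ _ n _ l]) (use cs RZ g(3) h(3) in auto)
  have TKT: "T * K * T = T"
    unfolding TK unfolding T_def
    by (subst mult_four_block_mat[of _ n n _ l _ l _ _ n _ l]) (use cs XS g(1) h(1) in \<open>auto simp del: assoc_mult_mat\<close>)
  have KTK: "K * T * K = K"
    unfolding KT unfolding K_def R_def[symmetric] g(3) h(3)
    by (subst mult_four_block_mat[of _ n n _ l _ l _ _ n _ l]) (use cs GXR g(2) h(2) in \<open>auto simp del: assoc_mult_mat\<close>)
  show "is_group_inverse T K"
    using TKT KTK TK KT cs unfolding is_group_inverse_def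
    by (auto simp: T_def K_def)
qed

lemma pow_upper_block:
  fixes A B D :: "complex mat"
  assumes A: "A \<in> carrier_mat n n" and B: "B \<in> carrier_mat n n" and D: "D \<in> carrier_mat n n"
  shows "four_block_mat A B (0\<^sub>m n n) D ^\<^sub>m m =
    four_block_mat (A ^\<^sub>m m) (mat_sum n (\<lambda>i. A ^\<^sub>m (m - i) * B * D ^\<^sub>m (i - 1)) {1..m})
      (0\<^sub>m n n) (D ^\<^sub>m m)"
proof (induction m)
  interpret R: ring "ring_mat TYPE(complex) n ()" by (rule ring_mat)
  case 0
  then show ?case using A D R.finsum_empty by (simp add: ring_mat_simps)
next
  interpret R: ring "ring_mat TYPE(complex) n ()" by (rule ring_mat)
  note rs = ring_mat_simps
  note a = assoc_mult_mat[of _ n n _ n _ n]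
  case (Suc m)
  let ?P = "four_block_mat A B (0\<^sub>m n n) D"
  let ?f = "\<lambda>m i. A ^\<^sub>m (m - i) * B * D ^\<^sub>m (i - 1)"
  let ?S = "\<lambda>m. mat_sum n (?f m) {1..m}"
  have f: "?f j i \<in> carrier_mat n n" for j i using A B D by (intro mult_carrier_mat[of _ n n _ n] pow_carrier_mat)
  have Sc: "?S j \<in> carrier_mat n n" for j
    using R.finsum_closed[of "?f j" "{1..j}"] f by (simp add: rs Pi_def)
  have "A * ?S m = mat_sum n (\<lambda>i. A * ?f m i) {1..m}"
    using R.finsum_rdistr[of "{1..m}" A "?f m"] f A by (simp add: rs Pi_def)
  also have "\<dots> = mat_sum n (?f (Suc m)) {1..m}"
  proof (rule R.finsum_cong')
    fix i assume "i \<in> {1..m}"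
    then have "Suc m - i = Suc (m - i)" by auto
    then show "A * ?f m i = ?f (Suc m) i"
      using A B D by (simp add: a mult_carrier_mat[of _ n n _ n] pow_mat_Suc_left[OF A] del: pow_mat.simps)
  qed (use f in \<open>auto simp: rs\<close>)
  finally have AS: "A * ?S m = mat_sum n (?f (Suc m)) {1..m}" .
  have I: "{1..Suc m} = insert (Suc m) {1..m}" by auto
  have "?S (Suc m) = ?f (Suc m) (Suc m) + mat_sum n (?f (Suc m)) {1..m}"
    unfolding I by (subst R.finsum_insert) (use f f[of "Suc m" "Suc m"] in \<open>simp_all add: rs Pi_def del: pow_mat.simps\<close>)
  also have "\<dots> = A * ?S m + B * D ^\<^sub>m m"
    unfolding AS[symmetric] using A B D Sc[of m] by (simp add: comm_add_mat[of _ n n])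
  finally have S: "?S (Suc m) = A * ?S m + B * D ^\<^sub>m m" .
  have "?P ^\<^sub>m Suc m = ?P * ?P ^\<^sub>m m"
    using A B D by (intro pow_mat_Suc_left[of _ "n + n"]) simp
  also have "\<dots> = four_block_mat (A ^\<^sub>m Suc m) (?S (Suc m)) (0\<^sub>m n n) (D ^\<^sub>m Suc m)"
    unfolding Suc.IH S pow_mat_Suc_left[OF A] pow_mat_Suc_left[OF D]
    by (subst mult_four_block_mat[of _ n n _ n _ n _ _ n _ n]) (use A B D Sc[of m] in auto)
  finally show ?case .
qed

text \<open>
  The next two lemmas identify the sums in the hypotheses of the theorem: they are the off-diagonal
  block of the \<open>m\<close>-th power multiplied by a spectral idempotent. The terms beyond the index drop out,
  since \<open>X\<^sup>j X\<^sup>\<pi> = 0\<close> for \<open>j\<close> at least the index of \<open>X\<close>.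
\<close>
lemma mat_sum_mult_spectral_idempotent:
  fixes A B D :: "complex mat"
  assumes A: "A \<in> carrier_mat n n" and B: "B \<in> carrier_mat n n" and D: "D \<in> carrier_mat n n"
    and Y: "is_drazin_inverse_at k D (drazin_inverse D)" and "k \<le> m"
  shows "mat_sum n (\<lambda>i. A ^\<^sub>m (m - i) * B * D ^\<^sub>m (i - 1)) {1..m} * spectral_idempotent D =
    mat_sum n (\<lambda>i. A ^\<^sub>m (m - i) * B * D ^\<^sub>m (i - 1) * spectral_idempotent D) {1..k}"
proof -
  interpret R: ring "ring_mat TYPE(complex) n ()" by (rule ring_mat)
  note rs = ring_mat_simps
  note mc = mult_carrier_mat[of _ n n _ n]
  let ?p = "spectral_idempotent D" and ?f = "\<lambda>i. A ^\<^sub>m (m - i) * B * D ^\<^sub>m (i - 1)"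
  have p: "?p \<in> carrier_mat n n" using pow_mult_spectral_idempotent(2)[OF D Y] by blast
  have f: "?f i \<in> carrier_mat n n" for i using A B D by (intro mc pow_carrier_mat)
  have fp: "?f i * ?p \<in> carrier_mat n n" for i by (rule mc[OF f p])
  have "mat_sum n ?f {1..m} * ?p = mat_sum n (\<lambda>i. ?f i * ?p) {1..m}"
    using R.finsum_ldistr[of "{1..m}" ?p ?f] f p by (simp add: rs Pi_def)
  also have "\<dots> = mat_sum n (\<lambda>i. ?f i * ?p) {1..k}"
  proof (rule R.add.finprod_mono_neutral_cong_right)
    fix i assume i: "i \<in> {1..m} - {1..k}"
    then have "D ^\<^sub>m (i - 1) * ?p = 0\<^sub>m n n"
      by (intro pow_mult_spectral_idempotent(1)[OF D Y]) auto
    then have "?f i * ?p = 0\<^sub>m n n"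
      using A B D p by (simp add: assoc_mult_mat[of _ n n _ n _ n] mc)
    then show "?f i * ?p = \<zero>\<^bsub>ring_mat TYPE(complex) n ()\<^esub>" by (simp add: rs)
  qed (use \<open>k \<le> m\<close> fp in \<open>auto simp: rs\<close>)
  finally show ?thesis .
qed

lemma spectral_idempotent_mult_mat_sum:
  fixes A B D :: "complex mat"
  assumes A: "A \<in> carrier_mat n n" and B: "B \<in> carrier_mat n n" and D: "D \<in> carrier_mat n n"
    and Y: "is_drazin_inverse_at k A (drazin_inverse A)" and "k \<le> m"
  shows "spectral_idempotent A * mat_sum n (\<lambda>i. A ^\<^sub>m (m - i) * B * D ^\<^sub>m (i - 1)) {1..m} =
    mat_sum n (\<lambda>i. A ^\<^sub>m (i - 1) * spectral_idempotent A * B * D ^\<^sub>m (m - i)) {1..k}"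
proof -
  interpret R: ring "ring_mat TYPE(complex) n ()" by (rule ring_mat)
  note rs = ring_mat_simps
  note mc = mult_carrier_mat[of _ n n _ n]
  note a = assoc_mult_mat[of _ n n _ n _ n]
  let ?p = "spectral_idempotent A" and ?f = "\<lambda>i. A ^\<^sub>m (m - i) * B * D ^\<^sub>m (i - 1)"
    and ?g = "\<lambda>i. A ^\<^sub>m (i - 1) * spectral_idempotent A * B * D ^\<^sub>m (m - i)"
    and ?h = "\<lambda>i. Suc m - i"
  have p: "?p \<in> carrier_mat n n" and Ap: "A * ?p = ?p * A"
    using pow_mult_spectral_idempotent(2,3)[OF A Y] by blast+
  have f: "?f i \<in> carrier_mat n n" for i using A B D by (intro mc pow_carrier_mat)
  have g: "?g i \<in> carrier_mat n n" for i using A B D p by (intro mc pow_carrier_mat)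
  have pf: "?p * ?f i \<in> carrier_mat n n" for i by (rule mc[OF p f])
  have h: "?h ` {1..m} = {1..m}"
  proof
    show "{1..m} \<subseteq> ?h ` {1..m}"
    proof
      fix i assume "i \<in> {1..m}"
      then show "i \<in> ?h ` {1..m}" by (intro image_eqI[of _ _ "Suc m - i"]) auto
    qed
  qed auto
  have inj: "inj_on ?h {1..m}" unfolding inj_on_def by auto
  have "?p * mat_sum n ?f {1..m} = mat_sum n (\<lambda>i. ?p * ?f i) {1..m}"
    using R.finsum_rdistr[of "{1..m}" ?p ?f] f p by (simp add: rs Pi_def)
  also have "\<dots> = mat_sum n (\<lambda>i. ?p * ?f (?h i)) {1..m}"
    using R.finsum_reindex[of "\<lambda>i. ?p * ?f i" ?h "{1..m}"] inj pf unfolding h by (simp add: rs Pi_def)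
  also have "\<dots> = mat_sum n ?g {1..k}"
  proof (rule R.add.finprod_mono_neutral_cong_right)
    show "(\<lambda>i. ?p * ?f (?h i)) \<in> {1..m} \<rightarrow> carrier (ring_mat TYPE(complex) n ())"
      unfolding rs by (rule Pi_I) (rule pf)
    have e: "?p * ?f (?h i) = ?g i" if "i \<in> {1..m}" for i
    proof -
      from that have "m - ?h i = i - 1" "?h i - 1 = m - i" by auto
      then have "?p * ?f (?h i) = ?p * A ^\<^sub>m (i - 1) * B * D ^\<^sub>m (m - i)"
        using A B D p by (simp add: a mc)
      then show ?thesis using pow_mat_commute[OF A p Ap] by simp
    qed
    then show "?p * ?f (?h i) = ?g i" if "i \<in> {1..k}" for i using that \<open>k \<le> m\<close> by simp
    fix i assume i: "i \<in> {1..m} - {1..k}"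
    then have "A ^\<^sub>m (i - 1) * ?p = 0\<^sub>m n n"
      by (intro pow_mult_spectral_idempotent(1)[OF A Y]) auto
    then have "?g i = 0\<^sub>m n n"
      using B D by simp
    then show "?p * ?f (?h i) = \<zero>\<^bsub>ring_mat TYPE(complex) n ()\<^esub>" using e i by (simp add: rs)
  qed (use \<open>k \<le> m\<close> in auto)
  finally show ?thesis .
qed

section \<open>The criterion for the full block matrix\<close>

lemma star_DMP_upper_block:
  fixes A B D :: "complex mat"
  assumes A: "A \<in> carrier_mat n n" and B: "B \<in> carrier_mat n n" and D: "D \<in> carrier_mat n n"
    and sA: "star_DMP A" and sD: "star_DMP D"
    and m: "m > 0" "drazin_index A \<le> m" "drazin_index D \<le> m"
    and sum1: "mat_sum n (\<lambda>i. A ^\<^sub>m (m - i) * B * D ^\<^sub>m (i - 1) * spectral_idempotent D)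
           {1..drazin_index D} = 0\<^sub>m n n"
    and sum2: "mat_sum n (\<lambda>i. A ^\<^sub>m (i - 1) * spectral_idempotent A * B * D ^\<^sub>m (m - i))
           {1..drazin_index A} = 0\<^sub>m n n"
  shows "star_DMP (four_block_mat A B (0\<^sub>m n n) D)"
proof -
  interpret R: ring "ring_mat TYPE(complex) n ()" by (rule ring_mat)
  let ?P = "four_block_mat A B (0\<^sub>m n n) D"
  let ?S = "mat_sum n (\<lambda>i. A ^\<^sub>m (m - i) * B * D ^\<^sub>m (i - 1)) {1..m}"
  let ?YA = "drazin_inverse A" and ?YD = "drazin_inverse D"
  note YA = star_DMP_drazin_inverse[OF A sA] and YD = star_DMP_drazin_inverse[OF D sD]
  have c: "?YA \<in> carrier_mat n n" "?YD \<in> carrier_mat n n"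
    using YA(1) YD(1) is_drazin_inverse_at_iff A D by blast+
  have EA: "A * ?YA \<in> carrier_mat n n" and ED: "D * ?YD \<in> carrier_mat n n"
    using A D c by auto
  have P: "?P \<in> carrier_mat (n + n) (n + n)" using A D by simp
  have "(\<lambda>i. A ^\<^sub>m (m - i) * B * D ^\<^sub>m (i - 1)) \<in> {1..m} \<rightarrow> carrier_mat n n"
    using A B D by (intro Pi_I mult_carrier_mat[of _ n n _ n] pow_carrier_mat)
  then have S: "?S \<in> carrier_mat n n"
    using R.finsum_closed by (simp add: ring_mat_simps)
  have cancel: "V = W" if "V \<in> carrier_mat n n" "W \<in> carrier_mat n n" "V - W = 0\<^sub>m n n"
    for V W :: "complex mat"
  proof (rule eq_matI)
    fix i j assume ij: "i < dim_row W" "j < dim_col W"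
    then have "V $$ (i, j) - W $$ (i, j) = (V - W) $$ (i, j)" by simp
    also have "\<dots> = 0" using that ij by simp
    finally show "V $$ (i, j) = W $$ (i, j)" by simp
  qed (use that in auto)
  have "spectral_idempotent A * ?S = 0\<^sub>m n n"
    using spectral_idempotent_mult_mat_sum[OF A B D YA(1) m(2)] sum2 by simp
  then have "?S - A * ?YA * ?S = 0\<^sub>m n n"
    using A S minus_mult_distrib_mat[OF one_carrier_mat EA S] by (simp add: spectral_idempotent_def)
  then have ES: "A * ?YA * ?S = ?S"
    by (rule cancel[OF S mult_carrier_mat[OF EA S], symmetric])
  have "?S * spectral_idempotent D = 0\<^sub>m n n"
    using mat_sum_mult_spectral_idempotent[OF A B D YD(1) m(3)] sum1 by simp
  then have "?S - ?S * (D * ?YD) = 0\<^sub>m n n"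
    using D S mult_minus_distrib_mat[OF S one_carrier_mat ED] by (simp add: spectral_idempotent_def)
  then have SE: "?S * (D * ?YD) = ?S"
    by (rule cancel[OF S mult_carrier_mat[OF S ED], symmetric])
  note pA = is_drazin_inverse_at_power[OF A YA(1) m(1,2)]
    and pD = is_drazin_inverse_at_power[OF D YD(1) m(1,3)]
  note G = is_group_inverse_upper_block[OF pow_carrier_mat[OF A] S pow_carrier_mat[OF D] pA(3) pD(3)]
  obtain K where "is_group_inverse (?P ^\<^sub>m m) K"
    "?P ^\<^sub>m m * K = four_block_mat (A * ?YA) (0\<^sub>m n n) (0\<^sub>m n n) (D * ?YD)"
    using G ES SE unfolding pow_upper_block[OF A B D] pA(1) pD(1) by blast
  moreover have "mat_adjoint (four_block_mat (A * ?YA) (0\<^sub>m n n) (0\<^sub>m n n) (D * ?YD)) =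
    four_block_mat (A * ?YA) (0\<^sub>m n n) (0\<^sub>m n n) (D * ?YD)"
    using mat_adjoint_diag_block[OF EA ED] YA(2) YD(2) by simp
  ultimately show ?thesis using star_DMP_iff_group_inverse[OF P] m(1) by metis
qed

theorem theorem4p6:
  fixes A B C D :: "complex mat" and n m :: nat
  assumes "A \<in> carrier_mat n n" and "B \<in> carrier_mat n n"
    and "C \<in> carrier_mat n n" and "D \<in> carrier_mat n n"
    and "star_DMP A" and "star_DMP D" and "star_DMP (B * C)" and "star_DMP (C * B)"
    and "B * C = 0\<^sub>m n n" and "C * B = 0\<^sub>m n n" and "C * A = D * C"
    and "A * mat_adjoint C = mat_adjoint C * D"
    and "m \<ge> max (drazin_index A) (drazin_index D)"
    and "mat_sum n (\<lambda>i. A ^\<^sub>m (m - i) * B * D ^\<^sub>m (i - 1) * spectral_idempotent D)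
           {1..drazin_index D} = 0\<^sub>m n n"
    and "mat_sum n (\<lambda>i. A ^\<^sub>m (i - 1) * spectral_idempotent A * B * D ^\<^sub>m (m - i))
           {1..drazin_index A} = 0\<^sub>m n n"
  shows "star_DMP (four_block_mat A B C D)"
proof -
  note A = assms(1) and B = assms(2) and C = assms(3) and D = assms(4)
  let ?P = "four_block_mat A B (0\<^sub>m n n) D"
    and ?Q = "four_block_mat (0\<^sub>m n n) (0\<^sub>m n n) C (0\<^sub>m n n)"
  have P: "?P \<in> carrier_mat (n + n) (n + n)" and Q: "?Q \<in> carrier_mat (n + n) (n + n)"
    using A D by simp_all
  have M: "four_block_mat A B C D = ?P + ?Q"
    by (subst add_four_block_mat[of _ n n _ n _ n]) (use A B C D in auto)
  have PQ: "?P * ?Q = four_block_mat (0\<^sub>m n n) (0\<^sub>m n n) (D * C) (0\<^sub>m n n)"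
    by (subst mult_four_block_mat[of _ n n _ n _ n _ _ n _ n]) (use A B C D assms(9) in auto)
  have QP: "?Q * ?P = four_block_mat (0\<^sub>m n n) (0\<^sub>m n n) (C * A) (0\<^sub>m n n)"
    by (subst mult_four_block_mat[of _ n n _ n _ n _ _ n _ n]) (use A B C D assms(10) in auto)
  have QQ: "?Q * ?Q = 0\<^sub>m (n + n) (n + n)"
    by (subst mult_four_block_mat[of _ n n _ n _ n _ _ n _ n]) (use C in auto)
  have "star_DMP ?P"
  proof (cases "m = 0")
    case False
    then show ?thesis using star_DMP_upper_block[OF A B D assms(5,6) _ _ _ assms(14,15)] assms(13) by simp
  next
    \<comment> \<open>Both indices vanish, so both sums are empty and \<open>m\<close> may be replaced by 1.\<close>
    case True
    interpret R: ring "ring_mat TYPE(complex) n ()" by (rule ring_mat)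
    have "drazin_index A = 0" "drazin_index D = 0" using True assms(13) by auto
    then show ?thesis
      by (intro star_DMP_upper_block[OF A B D assms(5,6), of 1])
        (simp_all add: R.finsum_empty ring_mat_simps)
  qed
  then obtain k Y where Y: "is_drazin_inverse_at k ?P Y" and h: "mat_adjoint (?P * Y) = ?P * Y"
    using star_DMP_iff_drazin[OF P] by blast
  have "?P * ?Q = ?Q * ?P" using PQ QP assms(11) by simp
  note N = is_drazin_inverse_at_add_nilpotent[OF P Q Y this QQ]
  show ?thesis
    unfolding M star_DMP_iff_drazin[OF add_carrier_mat[OF Q]] using N h by metis
qed

end
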